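(* Consider Thiele's method (party version) for a set $\mathcal P=\{1,\dots,N\}$ of $N$ parties with some given numbers of votes $\{v_\sigma\}_{\sigma\subseteq\mathcal P}$. Suppose that every party gets some individual vote, i.e., $v_{\{i\}}>0$ for every $i\in\mathcal P$. Then the system $$\sum_{\sigma\ni1}\frac{v_\sigma}{x_\sigma}=\sum_{\sigma\ni2}\frac{v_\sigma}{x_\sigma}=\dots=\sum_{\sigma\ni N}\frac{v_\sigma}{x_\sigma},\qquad\text{where } x_\sigma:=\sum_{i\in\sigma}x_i,$$ has a unique solution $\mathbf x_0$ in the open simplex $\mathfrak S^\circ=\{(x_1,\dots,x_N):x_i>0\text{ for all }i,\ \sum_{i=1}^Nx_i=1\}$, and $\mathbf p_n\to\mathbf x_0$ as $n\to\infty$. Moreover, $\mathbf x_0$ is a smooth function of the vote numbers $v_\sigma$ as long as $v_{\{i\}}>0$ for every $i\in\mathcal P$.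
   Context: Thiele's method, party version: for each $\sigma\subseteq\mathcal P$, the real number $v_\sigma\ge0$ is the (fixed) number of votes for the set $\sigma$ of parties. Seats are awarded one at a time. At each stage let $n_i$ be the number of seats so far awarded to party $i$ (initially $0$) and $n_\sigma:=\sum_{i\in\sigma}n_i$. The next seat goes to a party $i$ with the largest value of $W_i:=\sum_{\sigma\ni i}\frac{v_\sigma}{1+n_\sigma}$, ties being broken in an arbitrary way; each party may receive arbitrarily many seats. After $n\ge1$ seats have been distributed, $\mathbf p_n:=(n_1/n,\dots,n_N/n)$ is the vector of proportions of seats. *)

theory Defs
  imports "HOL-Analysis.Analysis"
begin

text \<open>
  The set of parties is a finite type \<open>'n\<close>. Vote numbers are vectors indexed by all subsets
  of \<open>'n\<close>, so that dependence on them is dependence on a point of a Euclidean space.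
\<close>

definition party_votes :: "(real ^ ('n::finite set)) set" where
  "party_votes = {v. (\<forall>\<sigma>. 0 \<le> v $ \<sigma>) \<and> (\<forall>i. 0 < v $ {i})}"


subsection \<open>Thiele's method\<close>

text \<open>
  A run of the method is recorded as \<open>s :: nat \<Rightarrow> 'n\<close>, where \<open>s k\<close> is the party that receives
  seat number \<open>k + 1\<close>.
\<close>

definition seats :: "(nat \<Rightarrow> 'n) \<Rightarrow> nat \<Rightarrow> 'n \<Rightarrow> nat" where
  "seats s n i = card {k. k < n \<and> s k = i}"

definition thiele_score :: "real ^ ('n::finite set) \<Rightarrow> ('n \<Rightarrow> nat) \<Rightarrow> 'n \<Rightarrow> real" where
  "thiele_score v m i = (\<Sum>\<sigma> | i \<in> \<sigma>. v $ \<sigma> / (1 + real (\<Sum>j\<in>\<sigma>. m j)))"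

text \<open>Any choice among the maximizing parties is allowed, so ties may be broken arbitrarily.\<close>

definition thiele_run :: "real ^ ('n::finite set) \<Rightarrow> (nat \<Rightarrow> 'n) \<Rightarrow> bool" where
  "thiele_run v s \<longleftrightarrow>
    (\<forall>n j. thiele_score v (seats s n) j \<le> thiele_score v (seats s n) (s n))"

text \<open>Meaningful for \<open>n \<ge> 1\<close>; the value at \<open>n = 0\<close> is irrelevant for limits.\<close>

definition seat_proportions :: "(nat \<Rightarrow> 'n) \<Rightarrow> nat \<Rightarrow> real ^ 'n::finite" where
  "seat_proportions s n = (\<chi> i. real (seats s n i) / real n)"


subsection \<open>The limiting system of equations\<close>

definition open_simplex :: "(real ^ 'n::finite) set" where
  "open_simplex = {x. (\<forall>i. 0 < x $ i) \<and> (\<Sum>i\<in>UNIV. x $ i) = 1}"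

definition vote_share :: "real ^ ('n::finite set) \<Rightarrow> real ^ 'n \<Rightarrow> 'n \<Rightarrow> real" where
  "vote_share v x i = (\<Sum>\<sigma> | i \<in> \<sigma>. v $ \<sigma> / (\<Sum>j\<in>\<sigma>. x $ j))"

definition balanced :: "real ^ ('n::finite set) \<Rightarrow> real ^ 'n \<Rightarrow> bool" where
  "balanced v x \<longleftrightarrow> (\<forall>i j. vote_share v x i = vote_share v x j)"

definition balanced_point :: "real ^ ('n::finite set) \<Rightarrow> real ^ 'n" where
  "balanced_point v = (THE x. x \<in> open_simplex \<and> balanced v x)"


subsection \<open>Smooth functions\<close>

text \<open>
  \<open>C_times k U f\<close>: on the open set \<open>U\<close>, all iterated directional derivatives of \<open>f\<close> of order less
  than \<open>k\<close> are Frechet differentiable, and those of order \<open>k\<close> are continuous. In finite dimension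
  this is \<open>C\<^sup>k\<close>.
\<close>

primrec C_times ::
  "nat \<Rightarrow> 'a::real_normed_vector set \<Rightarrow> ('a \<Rightarrow> 'b::real_normed_vector) \<Rightarrow> bool" where
  "C_times 0 U f \<longleftrightarrow> continuous_on U f"
| "C_times (Suc k) U f \<longleftrightarrow>
     (\<forall>x\<in>U. f differentiable (at x)) \<and>
     (\<forall>h. C_times k U (\<lambda>x. frechet_derivative f (at x) h))"

text \<open>
  Smoothness on a set that need not be open: near every point of the set, the function extends to
  a smooth function on an open neighbourhood. (\<open>party_votes\<close> is not open, since vote
  numbers other than those of singletons may vanish.)
\<close>

definition smooth_on ::
  "'a::real_normed_vector set \<Rightarrow> ('a \<Rightarrow> 'b::real_normed_vector) \<Rightarrow> bool" where
  "smooth_on S f \<longleftrightarrow>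
    (\<forall>p\<in>S. \<exists>U g. open U \<and> p \<in> U \<and> (\<forall>k. C_times k U g) \<and> (\<forall>x\<in>S \<inter> U. g x = f x))"

end

theory Submission imports Defs begin

text \<open>
  Summing \<open>x\<^sub>i W\<^sub>i(x)\<close> over \<open>i\<close> always gives the total number \<open>C\<close> of nonempty votes, so the balanced points
  of the open simplex are exactly the positive solutions of \<open>W\<^sub>i(x) = C\<close>. They are the maximizers of
  the strictly concave function \<open>\<Sum> v\<^sub>\<sigma> ln x\<^sub>\<sigma>\<close>, which gives existence and uniqueness.

  For the convergence let \<open>D\<^sub>n = \<Sum> v\<^sub>\<sigma> ln (n x\<^sub>\<sigma> / (1 + n\<^sub>\<sigma>))\<close>, where \<open>x\<close> is the balanced point. The
  score of the winning party is at least the average of all scores with weights \<open>x\<^sub>i\<close>, which by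
  \<open>u \<ge> 1 + ln u\<close> is at least \<open>(C + D\<^sub>n) / n\<close>. Hence \<open>D\<^sub>n\<^sub>+\<^sub>1 \<le> (1 - 1/n) D\<^sub>n + O(1/n\<^sup>2)\<close>, so \<open>D\<^sub>n\<close> is at
  most \<open>O(log n / n)\<close>. On the other hand \<open>D\<^sub>n + O(1/n)\<close> dominates a weighted sum of the squares of
  \<open>sqrt ((1 + n\<^sub>i) / (n x\<^sub>i)) - 1\<close>.

  For the smoothness, the Jacobian of the system in \<open>x\<close> is definite, so the inverse function theorem
  provides local solutions that are differentiable in the votes. By Cramer's rule their derivatives
  are rational expressions in the votes and in the solution itself, and differentiation can be
  iterated.
\<close>

subsection \<open>Existence and uniqueness of the balanced point\<close>

text \<open>Votes for the empty set enter no party's share and are left out, so that this is the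
  common value of the shares at a balanced point of the simplex.\<close>

definition total_votes :: "real ^ ('n::finite set) \<Rightarrow> real" where
  "total_votes v = (\<Sum>\<sigma>\<in>-{{}}. v $ \<sigma>)"

text \<open>Double counting of the pairs \<open>i \<in> \<sigma>\<close>. It translates sums over
  parties into sums over votes throughout. The empty set contributes zero and is dropped, so that
  all later denominators and arguments of \<open>ln\<close> are positive.\<close>

lemma sum_over_members:
  fixes y :: "'n::finite \<Rightarrow> real"
  shows "(\<Sum>i\<in>UNIV. y i * (\<Sum>\<sigma> | i \<in> \<sigma>. f \<sigma>)) = (\<Sum>\<sigma>\<in>-{{}}. f \<sigma> * (\<Sum>j\<in>\<sigma>. y j))"
proof -
  have "(\<Sum>i\<in>UNIV. y i * (\<Sum>\<sigma> | i \<in> \<sigma>. f \<sigma>))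
      = (\<Sum>i\<in>UNIV. \<Sum>\<sigma>\<in>UNIV. if i \<in> \<sigma> then y i * f \<sigma> else 0)"
    by (intro sum.cong) (auto simp: sum_distrib_left sum.If_cases)
  also have "\<dots> = (\<Sum>\<sigma>\<in>UNIV. \<Sum>i\<in>UNIV. if i \<in> \<sigma> then y i * f \<sigma> else 0)"
    by (rule sum.swap)
  also have "\<dots> = (\<Sum>\<sigma>\<in>UNIV. f \<sigma> * (\<Sum>j\<in>\<sigma>. y j))"
    by (intro sum.cong) (auto simp: sum_distrib_left sum.If_cases mult.commute)
  also have "\<dots> = (\<Sum>\<sigma>\<in>-{{}}. f \<sigma> * (\<Sum>j\<in>\<sigma>. y j))"
    by (intro sum.mono_neutral_right) auto
  finally show ?thesis .
qed

lemma sum_pos_nonempty: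
  fixes y :: "'n::finite \<Rightarrow> real"
  assumes "\<And>i. 0 < y i" "\<sigma> \<noteq> {}"
  shows "0 < (\<Sum>j\<in>\<sigma>. y j)"
  using assms by (intro sum_pos) auto

lemma total_votes_pos:
  assumes "v \<in> party_votes"
  shows "0 < total_votes v"
proof -
  have "0 < v $ {undefined}" using assms by (auto simp: party_votes_def)
  moreover have "v $ {undefined} \<le> total_votes v"
    unfolding total_votes_def using assms
    by (intro member_le_sum) (auto simp: party_votes_def)
  ultimately show ?thesis by simp
qed

text \<open>Each nonempty \<sigma> is counted with weight \<open>(\<Sum>j\<in>\<sigma>. x $ j) /
  (\<Sum>j\<in>\<sigma>. x $ j) = 1\<close>.\<close>

lemma sum_vote_share:
  assumes "\<And>i. 0 < x $ i"
  shows "(\<Sum>i\<in>UNIV. x $ i * vote_share v x i) = total_votes v"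
  unfolding vote_share_def sum_over_members total_votes_def
  by (intro sum.cong) (use assms sum_pos_nonempty[of "\<lambda>i. x $ i"] in \<open>auto simp: less_imp_neq[symmetric]\<close>)

text \<open>Equal shares on the simplex must equal their weighted average, which is the total.
  Conversely, shares equal to the total force the coordinates to sum to 1, because the total is
  positive. This absorbs the constraint and leaves as many equations as unknowns.\<close>

lemma in_simplex_and_balanced_iff:
  assumes v: "v \<in> party_votes"
  shows "x \<in> open_simplex \<and> balanced v x \<longleftrightarrow>
    (\<forall>i. 0 < x $ i) \<and> (\<forall>i. vote_share v x i = total_votes v)"
proof (cases "\<forall>i. 0 < x $ i")
  case pos: True
  have tot: "(\<Sum>i\<in>UNIV. x $ i * vote_share v x i) = total_votes v"
    using pos by (intro sum_vote_share) auto
  show ?thesis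
  proof
    assume asm: "x \<in> open_simplex \<and> balanced v x"
    have "vote_share v x i = total_votes v" for i
    proof -
      have "(\<Sum>k\<in>UNIV. x $ k * vote_share v x k) = (\<Sum>k\<in>UNIV. x $ k * vote_share v x i)"
        using asm by (intro sum.cong) (auto simp: balanced_def)
      also have "\<dots> = vote_share v x i"
        using asm by (simp add: open_simplex_def flip: sum_distrib_right)
      finally show ?thesis using tot by simp
    qed
    with pos show "(\<forall>i. 0 < x $ i) \<and> (\<forall>i. vote_share v x i = total_votes v)" by blast
  next
    assume asm: "(\<forall>i. 0 < x $ i) \<and> (\<forall>i. vote_share v x i = total_votes v)"
    then have "(\<Sum>i\<in>UNIV. x $ i) * total_votes v = total_votes v"
      using tot by (simp flip: sum_distrib_right)
    with total_votes_pos[OF v] asm show "x \<in> open_simplex \<and> balanced v x"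
      by (auto simp: open_simplex_def balanced_def)
  qed
qed (auto simp: open_simplex_def)

text \<open>Strict monotonicity: pairing \<open>x - y\<close> with the difference of the shares
  gives a sum of nonnegative terms, one per vote. If the shares agree, every term vanishes, and the
  singleton terms, with positive weight, give \<open>x = y\<close>.\<close>

lemma vote_share_inj:
  assumes v: "v \<in> party_votes" and x: "\<And>i. 0 < x $ i" and y: "\<And>i. 0 < y $ i"
    and eq: "\<And>i. vote_share v x i = vote_share v y i"
  shows "x = y"
proof -
  let ?X = "\<lambda>\<sigma>. \<Sum>j\<in>\<sigma>. x $ j" and ?Y = "\<lambda>\<sigma>. \<Sum>j\<in>\<sigma>. y $ j"
  have X: "0 < ?X \<sigma>" and Y: "0 < ?Y \<sigma>" if "\<sigma> \<noteq> {}" for \<sigma>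
    using sum_pos_nonempty[of "\<lambda>i. x $ i"] sum_pos_nonempty[of "\<lambda>i. y $ i"] x y that by auto
  have "0 = (\<Sum>i\<in>UNIV. (x $ i - y $ i) * (vote_share v y i - vote_share v x i))"
    using eq by simp
  also have "\<dots> = (\<Sum>\<sigma>\<in>-{{}}. (v $ \<sigma> / ?Y \<sigma> - v $ \<sigma> / ?X \<sigma>) * (\<Sum>j\<in>\<sigma>. x $ j - y $ j))"
    unfolding vote_share_def sum_subtractf[symmetric] by (rule sum_over_members)
  also have "\<dots> = (\<Sum>\<sigma>\<in>-{{}}. v $ \<sigma> * (?X \<sigma> - ?Y \<sigma>)\<^sup>2 / (?X \<sigma> * ?Y \<sigma>))"
  proof (intro sum.cong refl)
    fix \<sigma> :: "'a set" assume "\<sigma> \<in> -{{}}"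
    with X[of \<sigma>] Y[of \<sigma>]
    show "(v $ \<sigma> / ?Y \<sigma> - v $ \<sigma> / ?X \<sigma>) * (\<Sum>j\<in>\<sigma>. x $ j - y $ j)
      = v $ \<sigma> * (?X \<sigma> - ?Y \<sigma>)\<^sup>2 / (?X \<sigma> * ?Y \<sigma>)"
      by (simp add: sum_subtractf field_simps power2_eq_square)
  qed
  finally have sum0: "(\<Sum>\<sigma>\<in>-{{}}. v $ \<sigma> * (?X \<sigma> - ?Y \<sigma>)\<^sup>2 / (?X \<sigma> * ?Y \<sigma>)) = 0" ..
  have "0 \<le> v $ \<sigma> * (?X \<sigma> - ?Y \<sigma>)\<^sup>2 / (?X \<sigma> * ?Y \<sigma>)" if "\<sigma> \<in> -{{}}" for \<sigma>
    using v X[of \<sigma>] Y[of \<sigma>] that by (simp add: party_votes_def)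
  with sum0 have "\<forall>\<sigma>\<in>-{{}}. v $ \<sigma> * (?X \<sigma> - ?Y \<sigma>)\<^sup>2 / (?X \<sigma> * ?Y \<sigma>) = 0"
    by (subst (asm) sum_nonneg_eq_0_iff) auto
  then have "v $ {i} * (x $ i - y $ i)\<^sup>2 / (x $ i * y $ i) = 0" for i
    by (auto dest: bspec[where x = "{i}"])
  moreover have "v $ {i} \<noteq> 0" "x $ i \<noteq> 0" "y $ i \<noteq> 0" for i
    using v x[of i] y[of i] by (auto simp: party_votes_def less_imp_neq[symmetric])
  ultimately have "x $ i = y $ i" for i
    by (metis divide_eq_0_iff mult_eq_0_iff power_eq_0_iff eq_iff_diff_eq_0)
  then show ?thesis by (simp add: vec_eq_iff)
qed

section \<open>Existence by maximizing a logarithmic potential\<close>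

definition log_score :: "real ^ ('n::finite set) \<Rightarrow> real ^ 'n \<Rightarrow> real" where
  "log_score v x = (\<Sum>\<sigma>\<in>-{{}}. v $ \<sigma> * ln (\<Sum>j\<in>\<sigma>. x $ j))"

text \<open>The gradient of \<open>log_score v\<close> is the vector of shares. Moving mass from
  party \<open>j\<close> to party \<open>i\<close> preserves the coordinate sum, so these directions
  are the ones along which a maximizer on the simplex can be tested.\<close>

lemma log_score_transfer_deriv:
  fixes x :: "real ^ 'n::finite"
  assumes x: "\<And>i. 0 < x $ i"
  shows "((\<lambda>t. log_score v (x + t *\<^sub>R (axis i 1 - axis j 1)))
    has_real_derivative vote_share v x i - vote_share v x j) (at 0)"
proof -
  let ?d = "axis i 1 - axis j 1 :: real ^ 'n"
  have pos: "0 < (\<Sum>k\<in>\<sigma>. x $ k)" if "k \<in> \<sigma>" for \<sigma> k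
    using x that by (intro sum_pos_nonempty) auto
  have "((\<lambda>t. log_score v (x + t *\<^sub>R ?d)) has_real_derivative
      (\<Sum>\<sigma>\<in>-{{}}. v $ \<sigma> * (inverse (\<Sum>k\<in>\<sigma>. (x + 0 *\<^sub>R ?d) $ k) * (\<Sum>k\<in>\<sigma>. ?d $ k)))) (at 0)"
    unfolding log_score_def
    by (auto intro!: derivative_eq_intros simp: pos sum_distrib_left divide_inverse mult_ac)
  also have "(\<Sum>\<sigma>\<in>-{{}}. v $ \<sigma> * (inverse (\<Sum>k\<in>\<sigma>. (x + 0 *\<^sub>R ?d) $ k) * (\<Sum>k\<in>\<sigma>. ?d $ k)))
    = (\<Sum>\<sigma>\<in>-{{}}. v $ \<sigma> / (\<Sum>k\<in>\<sigma>. x $ k) * (\<Sum>k\<in>\<sigma>. ?d $ k))"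
    by (simp add: divide_inverse mult_ac)
  also have "\<dots> = (\<Sum>k\<in>UNIV. ?d $ k * vote_share v x k)"
    unfolding vote_share_def by (rule sum_over_members[symmetric])
  also have "\<dots> = vote_share v x i - vote_share v x j"
    by (simp add: axis_def left_diff_distrib sum_subtractf if_distrib[where f = "\<lambda>a. a * _"] cong: if_cong)
  finally show ?thesis .
qed

text \<open>The potential is maximized over the compact set \<open>K\<close> of simplex points with
  all coordinates at least \<epsilon>, which keeps the logarithms continuous. For small \<epsilon>
  the maximizer has no coordinate equal to \<epsilon>: such a party would have too large a share.
  Mass can then be moved both ways between any two parties, so all shares agree.\<close>

lemma ex_balanced:
  fixes v :: "real ^ ('n::finite set)"
  assumes v: "v \<in> party_votes"
  shows "\<exists>x. x \<in> open_simplex \<and> balanced v x"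
proof -
  define N where "N = real CARD('n)"
  define C where "C = total_votes v"
  have N: "1 \<le> N" by (simp add: N_def Suc_leI)
  have C: "0 < C" unfolding C_def using v by (rule total_votes_pos)
  define \<mu> where "\<mu> = Min (range (\<lambda>i. v $ {i}))"
  have \<mu>_le: "\<mu> \<le> v $ {i}" for i unfolding \<mu>_def by (intro Min_le) auto
  have \<mu>: "0 < \<mu>" unfolding \<mu>_def using v by (subst Min_gr_iff) (auto simp: party_votes_def)
  \<comment> \<open>The first bound puts the barycentre into \<open>K\<close> and lets a party with
    at least \<open>1 / N\<close> give mass away. The second makes the singleton vote alone push the
    share of a party at \<epsilon> above \<open>C * N\<close>. The factors 2 make both inequalities
    strict.\<close>
  define \<epsilon> where "\<epsilon> = min (1 / (2 * N)) (\<mu> / (2 * C * N))"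
  have \<epsilon>: "0 < \<epsilon>" "\<epsilon> < 1 / N" "\<epsilon> < \<mu> / (C * N)"
    using N C \<mu> by (auto simp: \<epsilon>_def min_def field_simps)
  define K where "K = {x :: real ^ 'n. (\<forall>i. \<epsilon> \<le> x $ i) \<and> (\<Sum>i\<in>UNIV. x $ i) = 1}"
  have Kpos: "0 < x $ i" if "x \<in> K" for x i
    using that \<epsilon>(1) less_le_trans[of 0 \<epsilon> "x $ i"] by (simp add: K_def)
  have "closed K"
    unfolding K_def by (intro closed_Collect_conj closed_Collect_all closed_Collect_le closed_Collect_eq continuous_intros)
  moreover have "bounded K"
  proof (rule boundedI)
    fix x assume "x \<in> K"
    then have "norm x \<le> (\<Sum>i\<in>UNIV. \<bar>x $ i\<bar>)" by (intro norm_le_l1_cart)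
    also have "\<dots> = (\<Sum>i\<in>UNIV. x $ i)"
      using Kpos[OF \<open>x \<in> K\<close>] by (simp add: less_imp_le)
    finally show "norm x \<le> 1" using \<open>x \<in> K\<close> by (simp add: K_def)
  qed
  ultimately have "compact K" by (simp add: compact_eq_bounded_closed)
  have Ksum: "0 < (\<Sum>j\<in>\<sigma>. x $ j)" if "x \<in> K" "\<sigma> \<noteq> {}" for x \<sigma>
    using Kpos that by (intro sum_pos_nonempty)
  have "(\<chi> i. 1 / N) \<in> K"
  proof -
    have "(\<Sum>i\<in>(UNIV :: 'n set). 1 / N) = 1" using N by (simp add: N_def)
    then show ?thesis using \<epsilon>(2) by (simp add: K_def less_imp_le del: sum_constant)
  qed
  then have "K \<noteq> {}" by blast
  have "continuous_on K (log_score v)"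
    unfolding log_score_def
  proof (intro continuous_on_sum continuous_on_mult continuous_on_const continuous_on_ln
      continuous_on_component continuous_on_id ballI)
    show "(\<Sum>j\<in>\<sigma>. x $ j) \<noteq> 0" if "\<sigma> \<in> -{{}}" "x \<in> K" for \<sigma> x
      using Ksum[of x \<sigma>] that by simp
  qed
  then obtain x where x: "x \<in> K" "\<And>y. y \<in> K \<Longrightarrow> log_score v y \<le> log_score v x"
    using continuous_attains_sup[OF \<open>compact K\<close> \<open>K \<noteq> {}\<close>] by blast
  have xpos: "0 < x $ i" for i using Kpos x by blast
  have xsum: "(\<Sum>i\<in>UNIV. x $ i) = 1" using x by (simp add: K_def)
  \<comment> \<open>One-sided first-order condition: a party above the lower bound can give mass
    away inside \<open>K\<close>, and giving it to a party with a larger share would increase the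
    potential.\<close>
  have transfer: "vote_share v x i \<le> vote_share v x j" if j: "\<epsilon> < x $ j" for i j
  proof (rule ccontr)
    assume "\<not> ?thesis"
    then have pos: "0 < vote_share v x i - vote_share v x j" and "i \<noteq> j" by auto
    from DERIV_pos_inc_right[OF log_score_transfer_deriv[OF xpos] pos] obtain \<delta> where
      \<delta>: "\<delta> > 0" "\<And>t. 0 < t \<Longrightarrow> t < \<delta> \<Longrightarrow>
        log_score v x < log_score v (x + t *\<^sub>R (axis i 1 - axis j 1))" by auto
    define t where "t = min (\<delta> / 2) (x $ j - \<epsilon>)"
    have t: "0 < t" "t < \<delta>" "t \<le> x $ j - \<epsilon>" using \<delta>(1) j by (auto simp: t_def min_def)
    have "x + t *\<^sub>R (axis i 1 - axis j 1) \<in> K"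
    proof -
      have "(\<Sum>k\<in>UNIV. (x + t *\<^sub>R (axis i 1 - axis j 1)) $ k) = 1"
        using xsum by (simp add: sum.distrib sum_subtractf axis_def flip: sum_distrib_left)
      moreover have "\<epsilon> \<le> (x + t *\<^sub>R (axis i 1 - axis j 1)) $ k" for k
      proof -
        have "\<epsilon> \<le> x $ k" using x(1) by (simp add: K_def)
        then show ?thesis using t \<open>i \<noteq> j\<close> by (cases "k = i"; cases "k = j") (simp_all add: axis_def)
      qed
      ultimately show ?thesis by (simp add: K_def)
    qed
    from x(2)[OF this] \<delta>(2)[OF t(1,2)] show False by simp
  qed
  obtain j where j: "1 / N \<le> x $ j"
  proof (rule ccontr)
    assume "\<not> thesis"
    with that have "(\<Sum>i\<in>UNIV. x $ i) < (\<Sum>i\<in>(UNIV :: 'n set). 1 / N)"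
      by (intro sum_strict_mono) (auto simp: not_le[symmetric])
    also have "\<dots> = 1" using N by (simp add: N_def)
    finally show False using xsum by simp
  qed
  have "vote_share v x j \<le> (\<Sum>\<sigma> | j \<in> \<sigma>. v $ \<sigma> / (1 / N))"
    unfolding vote_share_def
  proof (intro sum_mono divide_left_mono)
    fix \<sigma> assume "\<sigma> \<in> {\<sigma>. j \<in> \<sigma>}"
    then have "x $ j \<le> (\<Sum>k\<in>\<sigma>. x $ k)"
      using xpos by (intro member_le_sum) (auto intro: less_imp_le)
    with j show "1 / N \<le> (\<Sum>k\<in>\<sigma>. x $ k)" by simp
    moreover have "0 < 1 / N" using N by simp
    ultimately show "0 < (\<Sum>k\<in>\<sigma>. x $ k) * (1 / N)" by (intro mult_pos_pos) linarith+
    show "0 \<le> v $ \<sigma>" using v by (simp add: party_votes_def)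
  qed
  also have "\<dots> = (\<Sum>\<sigma> | j \<in> \<sigma>. v $ \<sigma>) * N" by (simp add: sum_distrib_right)
  also have "\<dots> \<le> C * N"
    using N v unfolding C_def total_votes_def
    by (intro mult_right_mono sum_mono2) (auto simp: party_votes_def)
  finally have Wj: "vote_share v x j \<le> C * N" .
  have interior: "\<epsilon> < x $ i" for i
  proof (rule ccontr)
    assume "\<not> ?thesis"
    moreover have "\<epsilon> \<le> x $ i" using x(1) by (simp add: K_def)
    ultimately have xi: "x $ i = \<epsilon>" by simp
    have "C * N < \<mu> / \<epsilon>" using \<epsilon> C N \<mu> by (simp add: field_simps)
    also have "\<dots> \<le> v $ {i} / x $ i" using \<mu>_le[of i] \<epsilon> by (simp add: xi divide_right_mono)
    also have "\<dots> = v $ {i} / (\<Sum>k\<in>{i}. x $ k)" by simp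
    also have "\<dots> \<le> vote_share v x i"
      unfolding vote_share_def
    proof (rule member_le_sum)
      show "0 \<le> v $ \<sigma> / (\<Sum>k\<in>\<sigma>. x $ k)" for \<sigma>
        using v xpos by (intro divide_nonneg_nonneg sum_nonneg) (auto simp: party_votes_def less_imp_le)
    qed auto
    also have "\<dots> \<le> vote_share v x j" using j \<epsilon>(2) by (intro transfer) linarith
    finally show False using Wj by simp
  qed
  have "x \<in> open_simplex" using xpos xsum by (simp add: open_simplex_def)
  moreover have "balanced v x"
    unfolding balanced_def by (intro allI antisym transfer interior)
  ultimately show ?thesis by blast
qed

lemma ex1_balanced:
  assumes v: "v \<in> party_votes"
  shows "\<exists>!x. x \<in> open_simplex \<and> balanced v x"
proof (rule ex_ex1I)
  show "\<exists>x. x \<in> open_simplex \<and> balanced v x" using v by (rule ex_balanced)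
next
  fix x y assume "x \<in> open_simplex \<and> balanced v x" "y \<in> open_simplex \<and> balanced v y"
  then show "x = y"
    unfolding in_simplex_and_balanced_iff[OF v] by (intro vote_share_inj[OF v]) simp_all
qed

lemma balanced_point:
  assumes v: "v \<in> party_votes"
  shows "0 < balanced_point v $ i" "vote_share v (balanced_point v) i = total_votes v"
    "(\<Sum>i\<in>UNIV. balanced_point v $ i) = 1"
proof -
  have *: "balanced_point v \<in> open_simplex \<and> balanced v (balanced_point v)"
    using theI'[OF ex1_balanced[OF v]] by (simp add: balanced_point_def)
  then show "(\<Sum>i\<in>UNIV. balanced_point v $ i) = 1" by (simp add: open_simplex_def)
  from * show "0 < balanced_point v $ i" "vote_share v (balanced_point v) i = total_votes v"
    unfolding in_simplex_and_balanced_iff[OF v] by simp_all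
qed

lemma balanced_point_eqI:
  assumes v: "v \<in> party_votes" and "\<And>i. 0 < x $ i" "\<And>i. vote_share v x i = total_votes v"
  shows "x = balanced_point v"
  using assms(2,3) balanced_point[OF v] by (intro vote_share_inj[OF v]) simp_all

subsection \<open>Convergence of Thiele's method\<close>

lemma seats_0 [simp]: "seats s 0 i = 0"
  by (simp add: seats_def)

lemma seats_Suc: "seats s (Suc n) i = seats s n i + of_bool (s n = i)"
proof -
  have "{k. k < Suc n \<and> s k = i} = {k. k < n \<and> s k = i} \<union> (if s n = i then {n} else {})"
    by (auto simp: less_Suc_eq)
  then show ?thesis by (simp add: seats_def)
qed

lemma sum_seats: "(\<Sum>i\<in>(UNIV :: 'n::finite set). seats s n i) = n"
  by (induction n) (simp_all add: seats_Suc sum.distrib of_bool_def)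

lemma sum_seats_Suc:
  fixes \<sigma> :: "'n::finite set"
  shows "(\<Sum>j\<in>\<sigma>. seats s (Suc n) j) = (\<Sum>j\<in>\<sigma>. seats s n j) + of_bool (s n \<in> \<sigma>)"
  by (simp add: seats_Suc sum.distrib of_bool_def)

text \<open>Only the term of the vote \<open>{i}\<close> is kept. Together with the upper bound
  below, this controls a party's score by its own seat count.\<close>

lemma thiele_score_ge:
  assumes "v \<in> party_votes"
  shows "v $ {i} / (1 + real (m i)) \<le> thiele_score v m i"
proof -
  have "v $ {i} / (1 + real (\<Sum>j\<in>{i}. m j)) \<le> thiele_score v m i"
    unfolding thiele_score_def
  proof (rule member_le_sum)
    show "0 \<le> v $ \<sigma> / (1 + real (\<Sum>j\<in>\<sigma>. m j))" for \<sigma>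
      using assms by (intro divide_nonneg_nonneg) (simp_all add: party_votes_def sum_nonneg)
  qed auto
  then show ?thesis by simp
qed

lemma thiele_score_le:
  assumes "v \<in> party_votes"
  shows "thiele_score v m i \<le> total_votes v / (1 + real (m i))"
proof -
  have "thiele_score v m i \<le> (\<Sum>\<sigma> | i \<in> \<sigma>. v $ \<sigma> / (1 + real (m i)))"
    unfolding thiele_score_def
  proof (intro sum_mono divide_left_mono)
    fix \<sigma> assume "\<sigma> \<in> {\<sigma>. i \<in> \<sigma>}"
    then have "m i \<le> (\<Sum>j\<in>\<sigma>. m j)" by (intro member_le_sum) auto
    then show "1 + real (m i) \<le> 1 + real (\<Sum>j\<in>\<sigma>. m j)" by linarith
    show "0 < (1 + real (\<Sum>j\<in>\<sigma>. m j)) * (1 + real (m i))"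
      by (intro mult_pos_pos) linarith+
    show "0 \<le> v $ \<sigma>" using assms by (simp add: party_votes_def)
  qed
  also have "\<dots> = (\<Sum>\<sigma> | i \<in> \<sigma>. v $ \<sigma>) / (1 + real (m i))"
    by (simp add: sum_divide_distrib)
  also have "\<dots> \<le> total_votes v / (1 + real (m i))"
    unfolding total_votes_def using assms
    by (intro divide_right_mono sum_mono2) (auto simp: party_votes_def)
  finally show ?thesis .
qed

text \<open>When \<open>i\<close> wins a seat, its score is at least that of \<open>j\<close>; the
  two score bounds then give the inequality with the new count of \<open>i\<close> already included.
  If another party wins, the left side is unchanged and the right side does not decrease.\<close>

lemma thiele_run_seats_comparable:
  assumes v: "v \<in> party_votes" and run: "thiele_run v s"
  shows "v $ {j} * real (seats s n i) \<le> total_votes v * (1 + real (seats s n j))"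
proof (induction n)
  case 0
  show ?case using total_votes_pos[OF v] by simp
next
  case (Suc n)
  let ?m = "seats s n"
  have C: "0 < total_votes v" by (rule total_votes_pos[OF v])
  have "v $ {j} * real (seats s (Suc n) i) \<le> total_votes v * (1 + real (?m j))"
  proof (cases "s n = i")
    case True
    have "v $ {j} / (1 + real (?m j)) \<le> thiele_score v ?m j" by (rule thiele_score_ge[OF v])
    also have "\<dots> \<le> thiele_score v ?m i" using run True by (auto simp: thiele_run_def)
    also have "\<dots> \<le> total_votes v / (1 + real (?m i))" by (rule thiele_score_le[OF v])
    finally have "v $ {j} * (1 + real (?m i)) \<le> total_votes v * (1 + real (?m j))"
      by (simp add: divide_simps)
    with True show ?thesis by (simp add: seats_Suc add.commute)
  next
    case False
    with Suc.IH show ?thesis by (simp add: seats_Suc)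
  qed
  also have "\<dots> \<le> total_votes v * (1 + real (seats s (Suc n) j))"
    using C by (intro mult_left_mono) (auto simp: seats_Suc)
  finally show ?case .
qed

text \<open>Summing the comparison over \<open>i\<close> replaces the seats of \<open>i\<close> by
  \<open>n\<close>. The constant is uniform in \<open>n\<close> and \<open>j\<close>; it later makes
  second-order errors of size \<open>1 / n\<close> squared.\<close>

lemma thiele_run_seats_linear:
  fixes v :: "real ^ ('n::finite set)"
  assumes v: "v \<in> party_votes" and run: "thiele_run v s"
  obtains M where "0 < M" "\<And>n j. real n \<le> M * (1 + real (seats s n j))"
proof -
  have vpos: "0 < v $ {j}" for j using v by (simp add: party_votes_def)
  define B where "B = (\<Sum>j\<in>UNIV. real CARD('n) * total_votes v / v $ {j})"
  have nn: "0 < real CARD('n) * total_votes v / v $ {j}" for j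
    using vpos total_votes_pos[OF v] by simp
  have le: "real n \<le> B * (1 + real (seats s n j))" for n j
  proof -
    have "v $ {j} * real n = (\<Sum>i\<in>UNIV. v $ {j} * real (seats s n i))"
      by (simp flip: sum_distrib_left of_nat_sum add: sum_seats)
    also have "\<dots> \<le> (\<Sum>i\<in>(UNIV::'n set). total_votes v * (1 + real (seats s n j)))"
      by (intro sum_mono thiele_run_seats_comparable[OF v run])
    finally have "real n \<le> real CARD('n) * total_votes v / v $ {j} * (1 + real (seats s n j))"
      using vpos[of j] by (simp add: field_simps)
    also have "\<dots> \<le> B * (1 + real (seats s n j))"
      unfolding B_def using nn less_imp_le[OF nn] by (intro mult_right_mono member_le_sum) simp_all
    finally show ?thesis .
  qed
  have "0 < B" unfolding B_def using nn by (intro sum_pos) auto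
  then show thesis using le that by blast
qed

section \<open>A logarithmic measure of the distance to the balanced point\<close>

lemma sqrt_minus_one_squared_le:
  fixes u :: real
  assumes "0 < u"
  shows "(sqrt u - 1)\<^sup>2 \<le> u - 1 - ln u"
proof -
  \<comment> \<open>Halving the logarithm before applying \<open>ln t \<le> t - 1\<close> leaves
    exactly the square as remainder.\<close>
  have "ln u = 2 * ln (sqrt u)" using assms by (simp add: ln_sqrt)
  also have "\<dots> \<le> 2 * (sqrt u - 1)" using assms by (intro mult_left_mono ln_le_minus_one) auto
  finally show ?thesis using assms by (simp add: power2_diff)
qed

text \<open>Up to the added 1, this is \<open>log_score\<close> at the balanced point minus
  \<open>log_score\<close> at the seat proportions. The 1 matches the denominators of the scores and
  keeps the logarithms finite for sets without seats.\<close>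

definition log_gap :: "real ^ ('n::finite set) \<Rightarrow> (nat \<Rightarrow> 'n) \<Rightarrow> nat \<Rightarrow> real" where
  "log_gap v s n = (\<Sum>\<sigma>\<in>-{{}}. v $ \<sigma> *
     ln ((\<Sum>j\<in>\<sigma>. balanced_point v $ j) * real n / (1 + real (\<Sum>j\<in>\<sigma>. seats s n j))))"

text \<open>To first order, the new seat adds \<open>1 / n\<close> for every vote and subtracts the
  winner's score. The lower bound on that score cancels \<open>total_votes v / n\<close> and leaves
  the contraction \<open>- log_gap v s n / n\<close>.\<close>

lemma log_gap_Suc_le:
  fixes v :: "real ^ ('n::finite set)"
  assumes v: "v \<in> party_votes" and run: "thiele_run v s" and n: "0 < n"
    and M: "0 < M" "\<And>j. real n \<le> M * (1 + real (seats s n j))"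
  shows "log_gap v s (Suc n) \<le> log_gap v s n - log_gap v s n / n + total_votes v * M\<^sup>2 / n\<^sup>2"
proof -
  let ?x = "balanced_point v" and ?m = "seats s n" and ?C = "total_votes v"
  let ?X = "\<lambda>\<sigma>. \<Sum>j\<in>\<sigma>. ?x $ j"
  define a where "a \<sigma> = 1 + real (\<Sum>j\<in>\<sigma>. ?m j)" for \<sigma>
  have X: "0 < ?X \<sigma>" if "\<sigma> \<noteq> {}" for \<sigma>
    using balanced_point(1)[OF v] that by (intro sum_pos_nonempty)
  have a: "1 \<le> a \<sigma>" for \<sigma> by (simp add: a_def sum_nonneg)
  have vnn: "0 \<le> v $ \<sigma>" for \<sigma> using v by (simp add: party_votes_def)
  have term_le: "ln (?X \<sigma> * real (Suc n) / (1 + real (\<Sum>j\<in>\<sigma>. seats s (Suc n) j)))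
      \<le> ln (?X \<sigma> * real n / a \<sigma>) + (1 / n + M\<^sup>2 / n\<^sup>2 - of_bool (s n \<in> \<sigma>) / a \<sigma>)"
    if \<sigma>: "\<sigma> \<noteq> {}" for \<sigma>
  proof -
    have "ln (real (Suc n)) - ln (real n) = ln (1 + 1 / n)"
    proof -
      have "1 + 1 / n = real (Suc n) / n" using n by (simp add: field_simps)
      then show ?thesis using n by (simp add: ln_div del: of_nat_Suc)
    qed
    also have "\<dots> \<le> 1 / n" using n by (intro ln_add_one_self_le_self) simp
    finally have 1: "ln (real (Suc n)) - ln (real n) \<le> 1 / n" .
    \<comment> \<open>For a set containing the winner, \<open>ln (1 + t) \<ge> t - t * t\<close> is
      used at \<open>t = 1 / a \<sigma>\<close>, and linear growth of the winner's seats gives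
      \<open>t \<le> M / n\<close>.\<close>
    have 2: "of_bool (s n \<in> \<sigma>) / a \<sigma> - M\<^sup>2 / n\<^sup>2 \<le> ln (a \<sigma> + of_bool (s n \<in> \<sigma>)) - ln (a \<sigma>)"
    proof (cases "s n \<in> \<sigma>")
      case True
      have "?m (s n) \<le> (\<Sum>j\<in>\<sigma>. ?m j)" using True by (intro member_le_sum) auto
      then have "1 + real (?m (s n)) \<le> a \<sigma>" unfolding a_def by linarith
      then have "M * (1 + real (?m (s n))) \<le> M * a \<sigma>" using M(1) by simp
      with M(2)[of "s n"] have "real n \<le> M * a \<sigma>" by linarith
      then have "1 / a \<sigma> \<le> M / n" using a[of \<sigma>] n by (simp add: field_simps)
      then have "(1 / a \<sigma>)\<^sup>2 \<le> (M / n)\<^sup>2" using a[of \<sigma>] by (intro power_mono) auto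
      then have "1 / a \<sigma> - M\<^sup>2 / n\<^sup>2 \<le> 1 / a \<sigma> - (1 / a \<sigma>)\<^sup>2" by (simp add: power_divide)
      also have "\<dots> \<le> ln (1 + 1 / a \<sigma>)"
        using a[of \<sigma>] by (intro ln_one_plus_pos_lower_bound) auto
      also have "1 + 1 / a \<sigma> = (a \<sigma> + 1) / a \<sigma>" using a[of \<sigma>] by (simp add: field_simps)
      also have "ln \<dots> = ln (a \<sigma> + 1) - ln (a \<sigma>)" using a[of \<sigma>] by (simp add: ln_div)
      finally show ?thesis using True by simp
    qed simp
    have "ln (?X \<sigma> * real (Suc n) / (1 + real (\<Sum>j\<in>\<sigma>. seats s (Suc n) j)))
        = ln (?X \<sigma>) + ln (real (Suc n)) - ln (a \<sigma> + of_bool (s n \<in> \<sigma>))"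
      using X[OF \<sigma>] a[of \<sigma>] unfolding sum_seats_Suc a_def
      by (subst ln_div) (simp_all add: ln_mult add_ac)
    moreover have "ln (?X \<sigma> * real n / a \<sigma>) = ln (?X \<sigma>) + ln (real n) - ln (a \<sigma>)"
      using X[OF \<sigma>] a[of \<sigma>] n by (subst ln_div) (simp_all add: ln_mult)
    ultimately show ?thesis using 1 2 by linarith
  qed
  have score: "(?C + log_gap v s n) / n \<le> thiele_score v ?m (s n)"
  proof -
    have "?C + log_gap v s n = (\<Sum>\<sigma>\<in>-{{}}. v $ \<sigma> * (1 + ln (?X \<sigma> * real n / a \<sigma>)))"
      by (simp add: total_votes_def log_gap_def a_def distrib_left sum.distrib)
    also have "\<dots> \<le> (\<Sum>\<sigma>\<in>-{{}}. v $ \<sigma> * (?X \<sigma> * real n / a \<sigma>))"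
    proof (intro sum_mono mult_left_mono vnn)
      fix \<sigma> :: "'n set" assume "\<sigma> \<in> -{{}}"
      then have "0 < ?X \<sigma> * real n / a \<sigma>" using X[of \<sigma>] a[of \<sigma>] n by simp
      from ln_le_minus_one[OF this] show "1 + ln (?X \<sigma> * real n / a \<sigma>) \<le> ?X \<sigma> * real n / a \<sigma>"
        by simp
    qed
    also have "\<dots> = n * (\<Sum>\<sigma>\<in>-{{}}. v $ \<sigma> / a \<sigma> * ?X \<sigma>)"
      by (simp add: sum_distrib_left mult_ac)
    also have "(\<Sum>\<sigma>\<in>-{{}}. v $ \<sigma> / a \<sigma> * ?X \<sigma>) = (\<Sum>i\<in>UNIV. ?x $ i * thiele_score v ?m i)"
      unfolding thiele_score_def a_def by (rule sum_over_members[symmetric])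
    also have "\<dots> \<le> (\<Sum>i\<in>UNIV. ?x $ i * thiele_score v ?m (s n))"
      using run less_imp_le[OF balanced_point(1)[OF v]]
      by (intro sum_mono mult_left_mono) (auto simp: thiele_run_def)
    also have "\<dots> = thiele_score v ?m (s n)"
      using balanced_point(3)[OF v] by (simp flip: sum_distrib_right)
    finally show ?thesis using n by (simp add: field_simps)
  qed
  have "log_gap v s (Suc n) \<le> (\<Sum>\<sigma>\<in>-{{}}. v $ \<sigma> * (ln (?X \<sigma> * real n / a \<sigma>)
      + (1 / n + M\<^sup>2 / n\<^sup>2 - of_bool (s n \<in> \<sigma>) / a \<sigma>)))"
    unfolding log_gap_def by (intro sum_mono mult_left_mono term_le vnn) auto
  also have "\<dots> = log_gap v s n + ?C * (1 / n + M\<^sup>2 / n\<^sup>2)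
      - (\<Sum>\<sigma>\<in>-{{}}. v $ \<sigma> * (of_bool (s n \<in> \<sigma>) / a \<sigma>))"
  proof -
    have "(\<Sum>\<sigma>\<in>-{{}}. v $ \<sigma> * (l \<sigma> + (b - o' \<sigma>)))
        = (\<Sum>\<sigma>\<in>-{{}}. v $ \<sigma> * l \<sigma>) + ?C * b - (\<Sum>\<sigma>\<in>-{{}}. v $ \<sigma> * o' \<sigma>)"
      for l o' :: "'n set \<Rightarrow> real" and b
      by (simp add: total_votes_def distrib_left right_diff_distrib sum.distrib sum_subtractf
          sum_distrib_right)
    then show ?thesis by (simp add: log_gap_def a_def)
  qed
  also have "(\<Sum>\<sigma>\<in>-{{}}. v $ \<sigma> * (of_bool (s n \<in> \<sigma>) / a \<sigma>)) = thiele_score v ?m (s n)"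
    unfolding thiele_score_def a_def
    by (rule sum.mono_neutral_cong_right) auto
  also have "log_gap v s n + ?C * (1 / n + M\<^sup>2 / n\<^sup>2) - thiele_score v ?m (s n)
    \<le> log_gap v s n + ?C * (1 / n + M\<^sup>2 / n\<^sup>2) - (?C + log_gap v s n) / n"
    using score by simp
  also have "\<dots> = log_gap v s n - log_gap v s n / n + ?C * M\<^sup>2 / n\<^sup>2"
    by (simp add: distrib_left add_divide_distrib)
  finally show ?thesis .
qed

text \<open>Multiplied by \<open>k = Suc n\<close>, the recursion bounds \<open>k\<close> times the
  next gap by \<open>k - 1\<close> times the current one plus an error of order
  \<open>1 / k\<close>. The errors add up to a harmonic number.\<close>

lemma log_gap_upper:
  assumes v: "v \<in> party_votes" and run: "thiele_run v s"
    and M: "0 < M" "\<And>n j. real n \<le> M * (1 + real (seats s n j))"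
  shows "real n * log_gap v s (Suc n) \<le> total_votes v * M\<^sup>2 * harm n"
proof (induction n)
  \<comment> \<open>The factor \<open>n\<close> vanishes, so the gap after the first seat may have
    any value.\<close>
  case 0
  show ?case by (simp add: harm_def)
next
  case (Suc n)
  let ?k = "Suc n"
  have "real ?k * log_gap v s (Suc ?k)
      \<le> real ?k * (log_gap v s ?k - log_gap v s ?k / ?k + total_votes v * M\<^sup>2 / (real ?k)\<^sup>2)"
    using log_gap_Suc_le[OF v run _ M, of ?k] by (intro mult_left_mono) simp_all
  also have "\<dots> = real n * log_gap v s ?k + total_votes v * M\<^sup>2 / ?k"
  proof -
    have "k * (a - a / k + b / k\<^sup>2) = (k - 1) * a + b / k" if "k \<noteq> 0" for k a b :: real
      using that by (simp add: field_simps power2_eq_square)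
    from this[of "real ?k"] show ?thesis by simp
  qed
  also have "\<dots> \<le> total_votes v * M\<^sup>2 * harm ?k"
    using Suc.IH by (simp add: harm_Suc distrib_left divide_inverse)
  finally show ?case .
qed

text \<open>With \<open>u \<sigma>\<close> the ratio of
  \<open>1 + real (\<Sum>j\<in>\<sigma>. seats s n j)\<close> to its ideal value, the right side
  equals the sum of \<open>v $ \<sigma> * (u \<sigma> - 1 - ln (u \<sigma>))\<close>. All these
  terms are nonnegative, and the one for \<open>{i}\<close> dominates the left side.\<close>

lemma log_gap_lower:
  fixes v :: "real ^ ('n::finite set)"
  assumes v: "v \<in> party_votes" and n: "0 < n"
  shows "v $ {i} * (sqrt ((1 + real (seats s n i)) / (balanced_point v $ i * n)) - 1)\<^sup>2
    \<le> log_gap v s n + (\<Sum>\<sigma>\<in>-{{}}. v $ \<sigma> / (\<Sum>j\<in>\<sigma>. balanced_point v $ j)) / n"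
proof -
  let ?x = "balanced_point v" and ?m = "seats s n" and ?C = "total_votes v"
  let ?X = "\<lambda>\<sigma>. \<Sum>j\<in>\<sigma>. ?x $ j"
  define u where "u \<sigma> = (1 + real (\<Sum>j\<in>\<sigma>. ?m j)) / (?X \<sigma> * n)" for \<sigma>
  have X: "0 < ?X \<sigma>" if "\<sigma> \<noteq> {}" for \<sigma>
    using balanced_point(1)[OF v] that by (intro sum_pos_nonempty)
  have u: "0 < u \<sigma>" if "\<sigma> \<noteq> {}" for \<sigma>
    unfolding u_def using X[OF that] n by (intro divide_pos_pos mult_pos_pos) linarith+
  have vnn: "0 \<le> v $ \<sigma>" for \<sigma> using v by (simp add: party_votes_def)
  have "v $ {i} * (sqrt (u {i}) - 1)\<^sup>2 \<le> (\<Sum>\<sigma>\<in>-{{}}. v $ \<sigma> * (sqrt (u \<sigma>) - 1)\<^sup>2)"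
    by (rule member_le_sum) (auto intro: mult_nonneg_nonneg vnn)
  also have "\<dots> \<le> (\<Sum>\<sigma>\<in>-{{}}. v $ \<sigma> * (u \<sigma> - 1 - ln (u \<sigma>)))"
    by (intro sum_mono mult_left_mono sqrt_minus_one_squared_le u vnn) auto
  also have "\<dots> = (\<Sum>\<sigma>\<in>-{{}}. v $ \<sigma> * u \<sigma>) - ?C - (\<Sum>\<sigma>\<in>-{{}}. v $ \<sigma> * ln (u \<sigma>))"
    by (simp add: right_diff_distrib sum_subtractf total_votes_def)
  also have "(\<Sum>\<sigma>\<in>-{{}}. v $ \<sigma> * ln (u \<sigma>)) = - log_gap v s n"
    unfolding log_gap_def sum_negf[symmetric]
  proof (intro sum.cong refl)
    fix \<sigma> :: "'n set" assume "\<sigma> \<in> -{{}}"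
    have "?X \<sigma> * real n / (1 + real (\<Sum>j\<in>\<sigma>. ?m j)) = inverse (u \<sigma>)" by (simp add: u_def)
    then show "v $ \<sigma> * ln (u \<sigma>) = - (v $ \<sigma> * ln (?X \<sigma> * real n / (1 + real (\<Sum>j\<in>\<sigma>. ?m j))))"
      using u[of \<sigma>] \<open>\<sigma> \<in> -{{}}\<close> by (simp add: ln_inverse)
  qed
  also have "(\<Sum>\<sigma>\<in>-{{}}. v $ \<sigma> * u \<sigma>)
      = (\<Sum>\<sigma>\<in>-{{}}. v $ \<sigma> / ?X \<sigma>) / n + (\<Sum>\<sigma>\<in>-{{}}. v $ \<sigma> / ?X \<sigma> * (\<Sum>j\<in>\<sigma>. real (?m j))) / n"
    unfolding sum_divide_distrib sum.distrib[symmetric]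
    by (intro sum.cong) (simp_all add: u_def add_divide_distrib distrib_left)
  also have "(\<Sum>\<sigma>\<in>-{{}}. v $ \<sigma> / ?X \<sigma> * (\<Sum>j\<in>\<sigma>. real (?m j))) = (\<Sum>j\<in>UNIV. real (?m j) * vote_share v ?x j)"
    unfolding vote_share_def by (rule sum_over_members[symmetric])
  \<comment> \<open>Balancedness enters here: the linear part depends on the seats through their
    total alone and cancels against \<open>?C\<close>.\<close>
  also have "\<dots> = real (\<Sum>j\<in>UNIV. ?m j) * ?C"
    using balanced_point(2)[OF v] by (simp add: sum_distrib_right)
  also have "\<dots> = n * ?C" by (simp add: sum_seats)
  finally show ?thesis using n by (simp add: u_def)
qed

lemma seat_proportions_tendsto:
  fixes v :: "real ^ ('n::finite set)"
  assumes v: "v \<in> party_votes" and run: "thiele_run v s"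
  shows "seat_proportions s \<longlonglongrightarrow> balanced_point v"
proof (rule vec_tendstoI)
  fix i :: 'n
  let ?x = "balanced_point v"
  obtain M where M: "0 < M" "\<And>n j. real n \<le> M * (1 + real (seats s n j))"
    using thiele_run_seats_linear[OF v run] by blast
  define K where "K = total_votes v * M\<^sup>2"
  define L where "L = (\<Sum>\<sigma>\<in>-{{}}. v $ \<sigma> / (\<Sum>j\<in>\<sigma>. ?x $ j))"
  define u where "u n = (1 + real (seats s n i)) / (?x $ i * n)" for n
  have vi: "0 < v $ {i}" using v by (simp add: party_votes_def)
  have "\<bar>(sqrt (u (Suc n)) - 1)\<^sup>2\<bar> \<le> (K * (harm n / n) + L / Suc n) / v $ {i}"
    if n: "0 < n" for n
  proof -
    have "n * log_gap v s (Suc n) \<le> K * harm n"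
      unfolding K_def by (rule log_gap_upper[OF v run M])
    then have "log_gap v s (Suc n) \<le> K * (harm n / n)"
      using n by (simp add: field_simps)
    with log_gap_lower[OF v, of "Suc n" i s]
    have "v $ {i} * (sqrt (u (Suc n)) - 1)\<^sup>2 \<le> K * (harm n / n) + L / Suc n"
      unfolding u_def L_def by linarith
    then show ?thesis using vi by (simp add: pos_le_divide_eq mult.commute)
  qed
  then have bound: "\<forall>\<^sub>F n in sequentially.
      norm ((sqrt (u (Suc n)) - 1)\<^sup>2) \<le> (K * (harm n / n) + L / Suc n) / v $ {i}"
    by (auto intro: eventually_sequentiallyI[of 1])
  \<comment> \<open>Since \<open>harm n - ln n\<close> converges, \<open>harm n / n\<close> tends to
    0.\<close>
  have "(\<lambda>n. (harm n - ln (real n)) * (1 / real n) + ln (real n) / real n) \<longlonglongrightarrow> euler_mascheroni * 0 + 0"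
    by (intro tendsto_intros euler_mascheroni_LIMSEQ lim_1_over_n lim_ln_over_n)
  then have "(\<lambda>n. harm n / real n) \<longlonglongrightarrow> 0" by (simp add: diff_divide_distrib)
  moreover have "(\<lambda>n. L / real (Suc n)) \<longlonglongrightarrow> 0"
    using LIMSEQ_Suc[OF lim_const_over_n[of L]] by simp
  ultimately have "(\<lambda>n. (K * (harm n / n) + L / Suc n) / v $ {i}) \<longlonglongrightarrow> (K * 0 + 0) / v $ {i}"
    using vi by (intro tendsto_intros) auto
  then have "(\<lambda>n. (sqrt (u (Suc n)) - 1)\<^sup>2) \<longlonglongrightarrow> 0"
    by (intro Lim_null_comparison[OF bound]) simp
  then have "(\<lambda>n. sqrt (u (Suc n)) - 1) \<longlonglongrightarrow> 0"
    by (simp add: tendsto_null_power)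
  then have "(\<lambda>n. (sqrt (u (Suc n)) - 1 + 1)\<^sup>2) \<longlonglongrightarrow> (0 + 1)\<^sup>2"
    by (intro tendsto_intros)
  moreover have "0 \<le> u n" for n
    using balanced_point(1)[OF v, of i] by (simp add: u_def)
  ultimately have "(\<lambda>n. u (Suc n)) \<longlonglongrightarrow> 1" by simp
  moreover have "(\<lambda>n. 1 / real (Suc n)) \<longlonglongrightarrow> 0"
    using LIMSEQ_Suc[OF lim_1_over_n] by simp
  ultimately have "(\<lambda>n. ?x $ i * u (Suc n) - 1 / real (Suc n)) \<longlonglongrightarrow> ?x $ i * 1 - 0"
    by (intro tendsto_intros)
  \<comment> \<open>Undoes the added 1 in the numerator of \<open>u\<close>.\<close>
  moreover have "?x $ i * u (Suc n) - 1 / real (Suc n) = seat_proportions s (Suc n) $ i" for n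
  proof -
    have "?x $ i * u (Suc n) = (1 + real (seats s (Suc n) i)) / real (Suc n)"
      using balanced_point(1)[OF v, of i] by (simp add: u_def)
    then show ?thesis by (simp add: seat_proportions_def add_divide_distrib)
  qed
  ultimately have "(\<lambda>n. seat_proportions s (Suc n) $ i) \<longlonglongrightarrow> ?x $ i" by simp
  then show "(\<lambda>n. seat_proportions s n $ i) \<longlonglongrightarrow> ?x $ i"
    by (rule LIMSEQ_imp_Suc)
qed

subsection \<open>Smooth dependence on the votes\<close>

text \<open>Membership in a family of differentiable functions that is closed under directional
  derivatives passes to all iterated derivatives, so the order \<open>k\<close> is handled by a
  plain induction.\<close>

lemma C_times_closed_family:
  fixes F :: "('a::real_normed_vector \<Rightarrow> 'b::real_normed_vector) set"
  assumes "open U"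
    and diff: "\<And>f x. f \<in> F \<Longrightarrow> x \<in> U \<Longrightarrow> f differentiable (at x)"
    and deriv: "\<And>f h. f \<in> F \<Longrightarrow> (\<lambda>x. frechet_derivative f (at x) h) \<in> F"
    and "f \<in> F"
  shows "C_times k U f"
  using \<open>f \<in> F\<close>
proof (induction k arbitrary: f)
  case 0
  then show ?case
    by (auto intro!: continuous_at_imp_continuous_on differentiable_imp_continuous_within diff)
qed (auto simp: diff deriv)

text \<open>Rational expressions in the functions of \<open>G\<close>, with denominators that do not
  vanish on \<open>U\<close>. The rule \<open>cong\<close> ignores values off \<open>U\<close>,
  where the formulas for derivatives may fail.\<close>

inductive generated :: "'a set \<Rightarrow> ('a \<Rightarrow> real) set \<Rightarrow> ('a \<Rightarrow> real) \<Rightarrow> bool" for U G where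
  gen: "f \<in> G \<Longrightarrow> generated U G f"
| const: "generated U G (\<lambda>x. c)"
| add: "generated U G f \<Longrightarrow> generated U G g \<Longrightarrow> generated U G (\<lambda>x. f x + g x)"
| mult: "generated U G f \<Longrightarrow> generated U G g \<Longrightarrow> generated U G (\<lambda>x. f x * g x)"
| inverse: "generated U G f \<Longrightarrow> \<forall>x\<in>U. f x \<noteq> 0 \<Longrightarrow> generated U G (\<lambda>x. inverse (f x))"
| cong: "generated U G f \<Longrightarrow> \<forall>x\<in>U. g x = f x \<Longrightarrow> generated U G g"

lemma generated_minus: "generated U G f \<Longrightarrow> generated U G (\<lambda>x. - f x)"
  using generated.mult[OF generated.const[of U G "-1"]] by simp

lemma generated_diff:
  "generated U G f \<Longrightarrow> generated U G g \<Longrightarrow> generated U G (\<lambda>x. f x - g x)"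
  using generated.add[OF _ generated_minus] by fastforce

lemma generated_divide:
  "generated U G f \<Longrightarrow> generated U G g \<Longrightarrow> \<forall>x\<in>U. g x \<noteq> 0 \<Longrightarrow> generated U G (\<lambda>x. f x / g x)"
  unfolding divide_inverse by (intro generated.mult generated.inverse)

lemma generated_sum:
  "(\<And>i. i \<in> I \<Longrightarrow> generated U G (f i)) \<Longrightarrow> generated U G (\<lambda>x. \<Sum>i\<in>I. f i x)"
  by (induction I rule: infinite_finite_induct) (auto intro: generated.intros)

lemma generated_prod:
  "(\<And>i. i \<in> I \<Longrightarrow> generated U G (f i)) \<Longrightarrow> generated U G (\<lambda>x. \<Prod>i\<in>I. f i x)"
  by (induction I rule: infinite_finite_induct) (auto intro: generated.intros)

lemma generated_det:
  fixes A :: "'a \<Rightarrow> real ^ 'n ^ 'n"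
  assumes "\<And>i j. generated U G (\<lambda>x. A x $ i $ j)"
  shows "generated U G (\<lambda>x. det (A x))"
  unfolding det_def by (intro generated_sum generated.mult generated_prod generated.const assms)

text \<open>Sum, product and reciprocal rules reduce closure under differentiation to the
  generators. Their derivatives may be any generated functions, which admits a function whose
  derivative is rational in the function itself.\<close>

lemma generated_differentiable:
  fixes G :: "('a::real_normed_vector \<Rightarrow> real) set"
  assumes U: "open U"
    and G: "\<And>f. f \<in> G \<Longrightarrow> (\<forall>x\<in>U. f differentiable (at x)) \<and>
      (\<forall>h. generated U G (\<lambda>x. frechet_derivative f (at x) h))"
    and "generated U G f"
  shows "(\<forall>x\<in>U. f differentiable (at x)) \<and> (\<forall>h. generated U G (\<lambda>x. frechet_derivative f (at x) h))"
  using \<open>generated U G f\<close>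
proof (induction rule: generated.induct)
  case (gen f)
  then show ?case by (rule G)
next
  case (const c)
  then show ?case by (auto intro: generated.const)
next
  case (add f g)
  let ?D = "\<lambda>f x. frechet_derivative f (at x)"
  have D: "((\<lambda>x. f x + g x) has_derivative (\<lambda>h. ?D f x h + ?D g x h)) (at x)" if "x \<in> U" for x
    using add that by (intro has_derivative_add) (auto simp: frechet_derivative_works[symmetric])
  have "generated U G (\<lambda>x. ?D f x h + ?D g x h)" for h
    using add by (intro generated.add) auto
  then have "generated U G (\<lambda>x. ?D (\<lambda>x. f x + g x) x h)" for h
    by (rule generated.cong) (auto simp: frechet_derivative_at[OF D, symmetric])
  with D show ?case by (auto simp: differentiable_def)
next
  case (mult f g)
  let ?D = "\<lambda>f x. frechet_derivative f (at x)"
  have D: "((\<lambda>x. f x * g x) has_derivative (\<lambda>h. f x * ?D g x h + ?D f x h * g x)) (at x)"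
    if "x \<in> U" for x
    using mult that by (intro has_derivative_mult) (auto simp: frechet_derivative_works[symmetric])
  have "generated U G (\<lambda>x. f x * ?D g x h + ?D f x h * g x)" for h
    using mult by (intro generated.add generated.mult) auto
  then have "generated U G (\<lambda>x. ?D (\<lambda>x. f x * g x) x h)" for h
    by (rule generated.cong) (auto simp: frechet_derivative_at[OF D, symmetric])
  with D show ?case by (auto simp: differentiable_def)
next
  case (inverse f)
  let ?D = "\<lambda>f x. frechet_derivative f (at x)"
  have D: "((\<lambda>x. inverse (f x)) has_derivative
      (\<lambda>h. - (inverse (f x) * ?D f x h * inverse (f x)))) (at x)" if "x \<in> U" for x
    using inverse that by (intro Deriv.has_derivative_inverse) (auto simp: frechet_derivative_works[symmetric])
  have "generated U G (\<lambda>x. - (inverse (f x) * ?D f x h * inverse (f x)))" for h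
    using inverse by (intro generated_minus generated.mult generated.inverse) auto
  then have "generated U G (\<lambda>x. ?D (\<lambda>x. inverse (f x)) x h)" for h
    by (rule generated.cong) (auto simp: frechet_derivative_at[OF D, symmetric])
  with D show ?case by (auto simp: differentiable_def)
next
  case (cong f g)
  let ?D = "\<lambda>f x. frechet_derivative f (at x)"
  \<comment> \<open>Agreement on the open set \<open>U\<close> determines the derivative at its
    points.\<close>
  have D: "(g has_derivative ?D f x) (at x)" if "x \<in> U" for x
    by (rule has_derivative_transform_within_open[OF _ U that])
      (use cong that in \<open>auto simp: frechet_derivative_works[symmetric]\<close>)
  have "generated U G (\<lambda>x. ?D g x h)" for h
    by (rule generated.cong[of _ _ "\<lambda>x. ?D f x h"]) (use cong in \<open>auto simp: frechet_derivative_at[OF D, symmetric]\<close>)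
  with D show ?case by (auto simp: differentiable_def)
qed

lemma has_derivative_vec_componentwise:
  fixes f :: "'a::real_normed_vector \<Rightarrow> real ^ 'n::finite"
  assumes "\<And>i. ((\<lambda>x. f x $ i) has_derivative (\<lambda>h. f' h $ i)) (at x)"
  shows "(f has_derivative f') (at x)"
  using assms by (subst has_derivative_componentwise_within) (auto simp: Basis_vec_def inner_axis)

lemma generated_C_times:
  fixes G :: "('a::real_normed_vector \<Rightarrow> real) set" and f :: "'a \<Rightarrow> real ^ 'n::finite"
  assumes U: "open U"
    and G: "\<And>f. f \<in> G \<Longrightarrow> (\<forall>x\<in>U. f differentiable (at x)) \<and>
      (\<forall>h. generated U G (\<lambda>x. frechet_derivative f (at x) h))"
    and "\<And>i. generated U G (\<lambda>x. f x $ i)"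
  shows "C_times k U f"
proof (rule C_times_closed_family[OF U])
  let ?F = "{f :: 'a \<Rightarrow> real ^ 'n. \<forall>i. generated U G (\<lambda>x. f x $ i)}"
  show "f \<in> ?F" using assms(3) by simp
  fix f assume f: "f \<in> ?F"
  have *: "(\<forall>x\<in>U. (\<lambda>x. f x $ i) differentiable (at x)) \<and>
      (\<forall>h. generated U G (\<lambda>x. frechet_derivative (\<lambda>x. f x $ i) (at x) h))" for i
    using f by (intro generated_differentiable[OF U G]) auto
  have D: "(f has_derivative (\<lambda>h. \<chi> i. frechet_derivative (\<lambda>x. f x $ i) (at x) h)) (at x)"
    if "x \<in> U" for x
    using * that by (intro has_derivative_vec_componentwise) (simp add: frechet_derivative_works[symmetric])
  then show "f differentiable (at x)" if "x \<in> U" for x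
    using that by (auto simp: differentiable_def)
  show "(\<lambda>x. frechet_derivative f (at x) h) \<in> ?F" for h
  proof (intro CollectI allI)
    fix i
    show "generated U G (\<lambda>x. frechet_derivative f (at x) h $ i)"
      by (rule generated.cong[of _ _ "\<lambda>x. frechet_derivative (\<lambda>x. f x $ i) (at x) h"])
        (use * in \<open>auto simp: frechet_derivative_at[OF D, symmetric]\<close>)
  qed
qed

section \<open>The negated Jacobian of the shares and local solutions of the system\<close>

definition share_jacobian :: "real ^ ('n::finite set) \<Rightarrow> real ^ 'n \<Rightarrow> real ^ 'n ^ 'n" where
  "share_jacobian v x = (\<chi> i j. \<Sum>\<sigma> | i \<in> \<sigma> \<and> j \<in> \<sigma>. v $ \<sigma> / (\<Sum>k\<in>\<sigma>. x $ k)\<^sup>2)"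

lemma share_jacobian_mult:
  "(share_jacobian v x *v y) $ i = (\<Sum>\<sigma> | i \<in> \<sigma>. v $ \<sigma> / (\<Sum>k\<in>\<sigma>. x $ k)\<^sup>2 * (\<Sum>k\<in>\<sigma>. y $ k))"
proof -
  let ?f = "\<lambda>\<sigma>. if i \<in> \<sigma> then v $ \<sigma> / (\<Sum>k\<in>\<sigma>. x $ k)\<^sup>2 else 0"
  have "(\<Sum>\<sigma> | i \<in> \<sigma> \<and> j \<in> \<sigma>. v $ \<sigma> / (\<Sum>k\<in>\<sigma>. x $ k)\<^sup>2) = (\<Sum>\<sigma> | j \<in> \<sigma>. ?f \<sigma>)" for j
    by (subst sum.inter_filter[symmetric]) (auto intro!: sum.cong)
  then have "(share_jacobian v x *v y) $ i = (\<Sum>j\<in>UNIV. y $ j * (\<Sum>\<sigma> | j \<in> \<sigma>. ?f \<sigma>))"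
    by (simp add: matrix_vector_mult_def share_jacobian_def mult.commute)
  also have "\<dots> = (\<Sum>\<sigma>\<in>-{{}}. ?f \<sigma> * (\<Sum>k\<in>\<sigma>. y $ k))" by (rule sum_over_members)
  also have "\<dots> = (\<Sum>\<sigma> | i \<in> \<sigma>. v $ \<sigma> / (\<Sum>k\<in>\<sigma>. x $ k)\<^sup>2 * (\<Sum>k\<in>\<sigma>. y $ k))"
    by (rule sum.mono_neutral_cong_right) auto
  finally show ?thesis .
qed

text \<open>The quadratic form of the matrix at \<open>y\<close> is a sum of squares weighted by the
  votes; the positive singleton votes make it definite.\<close>

lemma share_jacobian_inj:
  assumes v: "v \<in> party_votes" and x: "\<And>i. 0 < x $ i" and 0: "share_jacobian v x *v y = 0"
  shows "y = 0"
proof -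
  let ?X = "\<lambda>\<sigma>. \<Sum>k\<in>\<sigma>. x $ k" and ?Y = "\<lambda>\<sigma>. \<Sum>k\<in>\<sigma>. y $ k"
  have "0 = (\<Sum>i\<in>UNIV. y $ i * (share_jacobian v x *v y) $ i)" using 0 by simp
  also have "\<dots> = (\<Sum>\<sigma>\<in>-{{}}. v $ \<sigma> / (?X \<sigma>)\<^sup>2 * ?Y \<sigma> * ?Y \<sigma>)"
    unfolding share_jacobian_mult by (rule sum_over_members)
  finally have sum0: "(\<Sum>\<sigma>\<in>-{{}}. v $ \<sigma> / (?X \<sigma>)\<^sup>2 * (?Y \<sigma> * ?Y \<sigma>)) = 0" by (simp add: mult.assoc)
  have "0 \<le> v $ \<sigma> / (?X \<sigma>)\<^sup>2 * (?Y \<sigma> * ?Y \<sigma>)" for \<sigma>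
    using v by (intro mult_nonneg_nonneg[OF divide_nonneg_nonneg]) (simp_all add: party_votes_def)
  with sum0 have "\<forall>\<sigma>\<in>-{{}}. v $ \<sigma> / (?X \<sigma>)\<^sup>2 * (?Y \<sigma> * ?Y \<sigma>) = 0"
    by (subst (asm) sum_nonneg_eq_0_iff) auto
  then have "v $ {i} / (x $ i)\<^sup>2 * (y $ i * y $ i) = 0" for i
    by (auto dest: bspec[where x = "{i}"])
  moreover have "v $ {i} / (x $ i)\<^sup>2 \<noteq> 0" for i
    using v x[of i] by (auto simp: party_votes_def dest: spec[of _ i])
  ultimately have "y $ i = 0" for i by (metis mult_eq_0_iff)
  then show ?thesis by (simp add: vec_eq_iff)
qed

lemma det_share_jacobian:
  assumes v: "v \<in> party_votes" and x: "\<And>i. 0 < x $ i"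
  shows "det (share_jacobian v x) \<noteq> 0"
proof -
  have "\<forall>y. share_jacobian v x *v y = 0 \<longrightarrow> y = 0"
    using share_jacobian_inj[OF v x] by blast
  then show ?thesis
    unfolding invertible_det_nz[symmetric] invertible_left_inverse matrix_left_invertible_ker .
qed

lemma linear_total_votes: "linear total_votes"
  by (rule linearI) (simp_all add: total_votes_def sum.distrib sum_distrib_left)

text \<open>For admissible votes, its zeros with positive coordinates are exactly the balanced
  points of the open simplex.\<close>

definition excess :: "real ^ ('n::finite set) \<Rightarrow> real ^ 'n \<Rightarrow> real ^ 'n" where
  "excess v x = (\<chi> i. vote_share v x i - total_votes v)"

text \<open>For fixed \<open>x\<close> the excess is linear in the votes, hence
  \<open>excess (V' h) (X z)\<close>. Letting votes and point both depend on \<open>z\<close> covers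
  the map on pairs as well as implicit differentiation along a solution.\<close>

lemma excess_has_derivative:
  fixes V :: "'b::real_normed_vector \<Rightarrow> real ^ ('n::finite set)" and X :: "'b \<Rightarrow> real ^ 'n"
  assumes x: "\<And>i. 0 < X z $ i" and V: "(V has_derivative V') (at z)" and X: "(X has_derivative X') (at z)"
  shows "((\<lambda>z. excess (V z) (X z)) has_derivative
    (\<lambda>h. excess (V' h) (X z) - share_jacobian (V z) (X z) *v X' h)) (at z)"
proof (rule has_derivative_vec_componentwise)
  fix i
  note comp = bounded_linear.has_derivative[OF bounded_linear_vec_nth]
  have pos: "(\<Sum>j\<in>\<sigma>. X z $ j) \<noteq> 0" if "i \<in> \<sigma>" for \<sigma>
    using sum_pos_nonempty[of "\<lambda>i. X z $ i" \<sigma>] x that by (metis empty_iff less_irrefl)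
  have "((\<lambda>z. vote_share (V z) (X z) i) has_derivative
      (\<lambda>h. \<Sum>\<sigma> | i \<in> \<sigma>. V' h $ \<sigma> / (\<Sum>j\<in>\<sigma>. X z $ j)
         - V z $ \<sigma> / (\<Sum>j\<in>\<sigma>. X z $ j)\<^sup>2 * (\<Sum>j\<in>\<sigma>. X' h $ j))) (at z)"
    unfolding vote_share_def
  proof (rule has_derivative_sum)
    fix \<sigma> assume "\<sigma> \<in> {\<sigma>. i \<in> \<sigma>}"
    then have nz: "(\<Sum>j\<in>\<sigma>. X z $ j) \<noteq> 0" using pos by simp
    have "((\<lambda>z. V z $ \<sigma> / (\<Sum>j\<in>\<sigma>. X z $ j)) has_derivative
      (\<lambda>h. (V' h $ \<sigma> * (\<Sum>j\<in>\<sigma>. X z $ j) - V z $ \<sigma> * (\<Sum>j\<in>\<sigma>. X' h $ j))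
         / ((\<Sum>j\<in>\<sigma>. X z $ j) * (\<Sum>j\<in>\<sigma>. X z $ j)))) (at z)"
      by (intro has_derivative_divide' has_derivative_sum comp V X nz)
    then show "((\<lambda>z. V z $ \<sigma> / (\<Sum>j\<in>\<sigma>. X z $ j)) has_derivative
      (\<lambda>h. V' h $ \<sigma> / (\<Sum>j\<in>\<sigma>. X z $ j)
         - V z $ \<sigma> / (\<Sum>j\<in>\<sigma>. X z $ j)\<^sup>2 * (\<Sum>j\<in>\<sigma>. X' h $ j))) (at z)"
      using nz by (simp add: diff_divide_distrib power2_eq_square)
  qed
  from has_derivative_diff[OF this
      bounded_linear.has_derivative[OF linear_total_votes[THEN linear_conv_bounded_linear[THEN iffD1]] V]]
  show "((\<lambda>z. excess (V z) (X z) $ i) has_derivative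
    (\<lambda>h. (excess (V' h) (X z) - share_jacobian (V z) (X z) *v X' h) $ i)) (at z)"
    by (simp add: excess_def share_jacobian_mult vote_share_def sum_subtractf algebra_simps)
qed


text \<open>The inverse function theorem is applied to \<open>\<Phi>\<close>, which keeps the votes
  and replaces the point by its excess. Restricting the local inverse to excess 0 gives
  \<open>g\<close>. The votes in \<open>U\<close> may be negative, so \<open>g\<close> extends past
  the boundary of \<open>party_votes\<close>.\<close>

lemma local_solution:
  fixes v :: "real ^ ('n::finite set)"
  assumes v: "v \<in> party_votes"
  obtains U g where "open U" "v \<in> U" "\<And>w. w \<in> U \<Longrightarrow> g differentiable (at w)"
    "\<And>w i. w \<in> U \<Longrightarrow> 0 < g w $ i" "\<And>w. w \<in> U \<Longrightarrow> excess w (g w) = 0"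
    "\<And>w. w \<in> U \<Longrightarrow> det (share_jacobian w (g w)) \<noteq> 0"
proof -
  define pos where "pos = {z :: (real ^ ('n set)) \<times> (real ^ 'n). \<forall>i. 0 < snd z $ i}"
  define dom where "dom = {z \<in> pos. det (share_jacobian (fst z) (snd z)) \<noteq> 0}"
  define \<Phi> :: "(real ^ ('n set)) \<times> (real ^ 'n) \<Rightarrow> (real ^ ('n set)) \<times> (real ^ 'n)"
    where "\<Phi> z = (fst z, excess (fst z) (snd z))" for z
  define D :: "(real ^ ('n set)) \<times> (real ^ 'n) \<Rightarrow> (real ^ ('n set)) \<times> (real ^ 'n) \<Rightarrow> (real ^ ('n set)) \<times> (real ^ 'n)"
    where "D z h = (fst h, excess (fst h) (snd z) - share_jacobian (fst z) (snd z) *v snd h)" for z h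
  define z0 where "z0 = (v, balanced_point v)"
  have nz: "(\<Sum>j\<in>\<sigma>. snd z $ j) \<noteq> 0" if "z \<in> pos" "i \<in> \<sigma>" for z \<sigma> i
    using sum_pos_nonempty[of "\<lambda>i. snd z $ i" \<sigma>] that unfolding pos_def
    by (metis (mono_tags, lifting) empty_iff less_irrefl mem_Collect_eq)
  have "open pos"
    unfolding pos_def Collect_all_eq by (intro open_INT ballI open_Collect_less continuous_intros) simp
  have cont_J: "continuous_on pos (\<lambda>z. share_jacobian (fst z) (snd z))"
    unfolding share_jacobian_def by (intro continuous_intros) (use nz in fastforce)
  have "continuous_on pos (\<lambda>z. det (share_jacobian (fst z) (snd z)))"
    unfolding det_def using cont_J by (intro continuous_intros)
  then have "open (pos \<inter> (\<lambda>z. det (share_jacobian (fst z) (snd z))) -` (-{0}))"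
    using \<open>open pos\<close> by (intro continuous_open_preimage) auto
  also have "pos \<inter> (\<lambda>z. det (share_jacobian (fst z) (snd z))) -` (-{0}) = dom"
    by (auto simp: dom_def)
  finally have "open dom" .
  have D: "(\<Phi> has_derivative D z) (at z)" if "z \<in> dom" for z
    unfolding \<Phi>_def D_def
    by (intro has_derivative_Pair has_derivative_fst has_derivative_snd excess_has_derivative has_derivative_ident)
      (use that in \<open>auto simp: dom_def pos_def\<close>)
  have blinfun: "blinfun_apply (Blinfun (D z)) = D z" if "z \<in> dom" for z
    using D[OF that] by (intro bounded_linear_Blinfun_apply has_derivative_bounded_linear)
  have cont: "continuous_on dom (\<lambda>z. Blinfun (D z))"
  proof (rule continuous_on_blinfun_componentwise)
    fix b
    have "continuous_on dom (\<lambda>z. D z b)"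
      unfolding D_def excess_def vote_share_def matrix_vector_mult_def
      by (intro continuous_intros continuous_on_subset[OF cont_J]) (use nz in \<open>auto simp: dom_def\<close>)
    then show "continuous_on dom (\<lambda>z. blinfun_apply (Blinfun (D z)) b)"
      by (rule continuous_on_eq) (simp add: blinfun)
  qed
  have "z0 \<in> dom"
    using balanced_point(1)[OF v] det_share_jacobian[OF v] by (simp add: dom_def pos_def z0_def)
  have "linear (D z0)"
    using D[OF \<open>z0 \<in> dom\<close>] by (intro bounded_linear.linear has_derivative_bounded_linear)
  \<comment> \<open>The derivative is block triangular with the identity on the votes, so its kernel
    reduces to that of the Jacobian.\<close>
  moreover have "inj (D z0)"
  proof (subst linear_injective_0[OF \<open>linear (D z0)\<close>], intro allI impI)
    fix h assume h: "D z0 h = 0"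
    then have "fst h = 0" by (simp add: D_def prod_eq_iff)
    with h have "share_jacobian v (balanced_point v) *v snd h = 0"
      by (simp add: D_def prod_eq_iff z0_def excess_def vote_share_def total_votes_def vec_eq_iff)
    with share_jacobian_inj[OF v balanced_point(1)[OF v]] \<open>fst h = 0\<close> show "h = 0"
      by (simp add: prod_eq_iff)
  qed
  ultimately obtain L where L: "linear L" "L \<circ> D z0 = id"
    using linear_injective_left_inverse by blast
  have "Blinfun L o\<^sub>L Blinfun (D z0) = id_blinfun"
    by (rule blinfun_eqI)
      (use fun_cong[OF L(2)] in \<open>simp add: blinfun[OF \<open>z0 \<in> dom\<close>] bounded_linear_Blinfun_apply L(1)
        linear_conv_bounded_linear[symmetric]\<close>)
  then obtain U' V \<Psi> \<Psi>' where *: "open U'" "U' \<subseteq> dom" "z0 \<in> U'" "open V" "\<Phi> z0 \<in> V"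
    "homeomorphism U' V \<Phi> \<Psi>" "\<And>y. y \<in> V \<Longrightarrow> (\<Psi> has_derivative (\<Psi>' y)) (at y)"
    using inverse_function_theorem[OF \<open>open dom\<close>, of \<Phi> "\<lambda>z. Blinfun (D z)" z0]
      D blinfun cont \<open>z0 \<in> dom\<close> by metis
  define U where "U = (\<lambda>w. (w, 0)) -` V"
  define g where "g w = snd (\<Psi> (w, 0))" for w
  have \<Psi>: "\<Psi> (w, 0) = (w, g w)" "(w, g w) \<in> dom" "excess w (g w) = 0" if "w \<in> U" for w
  proof -
    have "\<Phi> (\<Psi> (w, 0)) = (w, 0)" "\<Psi> (w, 0) \<in> dom"
      using that *(2,6) unfolding U_def homeomorphism_def by auto
    then show "\<Psi> (w, 0) = (w, g w)" "(w, g w) \<in> dom" "excess w (g w) = 0"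
      by (cases "\<Psi> (w, 0)"; simp add: \<Phi>_def g_def)+
  qed
  show thesis
  proof
    show "open U"
      unfolding U_def by (intro open_vimage *(4) continuous_intros)
    have "excess v (balanced_point v) = 0"
      using balanced_point(2)[OF v] by (simp add: excess_def vec_eq_iff)
    with *(5) show "v \<in> U" by (simp add: U_def \<Phi>_def z0_def)
    show "g differentiable (at w)" if "w \<in> U" for w
    proof -
      have "((\<lambda>w. \<Psi> (w, 0)) has_derivative (\<lambda>h. \<Psi>' (w, 0) (h, 0))) (at w)"
        by (rule has_derivative_compose[where f = "\<lambda>w. (w, 0)", OF _ *(7)])
          (use that in \<open>auto simp: U_def intro!: derivative_eq_intros\<close>)
      from has_derivative_snd[OF this] show ?thesis
        unfolding g_def by (rule differentiableI)
    qed
    show "0 < g w $ i" "excess w (g w) = 0" "det (share_jacobian w (g w)) \<noteq> 0" if "w \<in> U" for w i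
      using \<Psi>[OF that] by (auto simp: dom_def pos_def)
  qed
qed

text \<open>The generators are the vote coordinates and the components of the local solution
  \<open>g\<close>. Implicit differentiation expresses the derivatives of \<open>g\<close>
  rationally in these same functions, so all orders follow at once.\<close>

lemma smooth_on_balanced_point:
  "smooth_on (party_votes :: (real ^ ('n::finite set)) set) balanced_point"
  unfolding smooth_on_def
proof
  fix v :: "real ^ ('n set)" assume "v \<in> party_votes"
  then obtain U g where U: "open U" "v \<in> U" and diff: "\<And>w. w \<in> U \<Longrightarrow> g differentiable (at w)"
    and pos: "\<And>w i. w \<in> U \<Longrightarrow> 0 < g w $ i" and sol: "\<And>w. w \<in> U \<Longrightarrow> excess w (g w) = 0"
    and det: "\<And>w. w \<in> U \<Longrightarrow> det (share_jacobian w (g w)) \<noteq> 0"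
    by (rule local_solution) (rule that)
  define G where "G = range (\<lambda>\<sigma> w. w $ \<sigma>) \<union> range (\<lambda>i w. g w $ i)"
  let ?gen = "generated U G"
  have gen_vote: "?gen (\<lambda>w. w $ \<sigma>)" for \<sigma> by (rule generated.gen) (auto simp: G_def)
  have gen_g: "?gen (\<lambda>w. g w $ i)" for i by (rule generated.gen) (auto simp: G_def)
  have nz: "(\<Sum>j\<in>\<sigma>. g w $ j) \<noteq> 0" if "w \<in> U" "i \<in> \<sigma>" for w \<sigma> i
    using sum_pos_nonempty[of "\<lambda>i. g w $ i" \<sigma>] pos that by (metis empty_iff less_irrefl)
  have gen_excess: "?gen (\<lambda>w. excess h (g w) $ i)" for h i
    unfolding excess_def vote_share_def vec_lambda_beta
    by (intro generated_diff generated_sum generated_divide generated.const gen_g) (auto simp: nz)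
  have gen_jacobian: "?gen (\<lambda>w. share_jacobian w (g w) $ i $ j)" for i j
    unfolding share_jacobian_def vec_lambda_beta power2_eq_square
    by (intro generated_sum generated_divide generated.mult gen_vote gen_g) (auto simp: nz)
  \<comment> \<open>Numerator in Cramer's rule: column \<open>k\<close> is replaced by the
    right-hand side for the direction \<open>h\<close>.\<close>
  define \<Delta> where "\<Delta> h k w = det (\<chi> i j. if j = k then excess h (g w) $ i else share_jacobian w (g w) $ i $ j)"
    for h k w
  have gen_\<Delta>: "?gen (\<Delta> h k)" for h k
    unfolding \<Delta>_def
  proof (rule generated_det)
    show "?gen (\<lambda>w. (\<chi> i j. if j = k then excess h (g w) $ i
        else share_jacobian w (g w) $ i $ j) $ i $ j)" for i j
      by (cases "j = k") (simp_all add: gen_excess gen_jacobian)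
  qed
  have dg: "frechet_derivative g (at w) h $ k = \<Delta> h k w / det (share_jacobian w (g w))"
    if w: "w \<in> U" for w h k
  proof -
    let ?g' = "frechet_derivative g (at w)"
    have "((\<lambda>w. excess w (g w)) has_derivative
        (\<lambda>h. excess h (g w) - share_jacobian w (g w) *v ?g' h)) (at w)"
      using diff[OF w] pos[OF w]
      by (intro excess_has_derivative has_derivative_ident) (simp_all add: frechet_derivative_works[symmetric])
    \<comment> \<open>The excess is identically 0 along \<open>g\<close> on \<open>U\<close>;
      comparing the two derivatives gives a linear system for the derivative of
      \<open>g\<close>.\<close>
    moreover have "((\<lambda>w. excess w (g w)) has_derivative (\<lambda>h. 0)) (at w)"
      by (rule has_derivative_transform_within_open[OF has_derivative_const U(1) w]) (simp add: sol)
    ultimately have "(\<lambda>h. excess h (g w) - share_jacobian w (g w) *v ?g' h) = (\<lambda>h. 0)"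
      by (rule has_derivative_unique)
    then have "share_jacobian w (g w) *v ?g' h = excess h (g w)" by (simp add: fun_eq_iff)
    then show ?thesis unfolding cramer[OF det[OF w]] by (simp add: \<Delta>_def)
  qed
  have "C_times k U g" for k
  proof (rule generated_C_times[OF U(1), of G])
    fix f assume "f \<in> G"
    then consider \<sigma> where "f = (\<lambda>w. w $ \<sigma>)" | i where "f = (\<lambda>w. g w $ i)"
      by (auto simp: G_def)
    then show "(\<forall>x\<in>U. f differentiable (at x)) \<and> (\<forall>h. ?gen (\<lambda>x. frechet_derivative f (at x) h))"
    proof cases
      case 1
      have D: "(f has_derivative (\<lambda>h. h $ \<sigma>)) (at x)" for x
        unfolding 1 by (intro bounded_linear_imp_has_derivative bounded_linear_vec_nth)
      then show ?thesis
        by (auto simp: differentiable_def frechet_derivative_at[OF D, symmetric] intro: generated.const)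
    next
      case 2
      have D: "(f has_derivative (\<lambda>h. frechet_derivative g (at x) h $ i)) (at x)" if "x \<in> U" for x
        unfolding 2 using diff[OF that]
        by (intro bounded_linear.has_derivative[OF bounded_linear_vec_nth])
          (simp add: frechet_derivative_works[symmetric])
      have "?gen (\<lambda>w. \<Delta> h i w / det (share_jacobian w (g w)))" for h
        by (intro generated_divide gen_\<Delta> generated_det gen_jacobian) (simp add: det)
      then have "?gen (\<lambda>x. frechet_derivative f (at x) h)" for h
        by (rule generated.cong[of _ _ "\<lambda>w. \<Delta> h i w / det (share_jacobian w (g w))"])
          (simp add: frechet_derivative_at[OF D, symmetric] dg)
      with D show ?thesis by (auto simp: differentiable_def)
    qed
  qed (rule gen_g)
  \<comment> \<open>Uniqueness of positive solutions identifies \<open>g\<close> with the balanced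
    point at all admissible votes in \<open>U\<close>.\<close>
  moreover have "\<forall>w\<in>party_votes \<inter> U. g w = balanced_point w"
  proof
    fix w assume w: "w \<in> party_votes \<inter> U"
    with sol[of w] have "vote_share w (g w) i = total_votes w" for i
      by (simp add: excess_def vec_eq_iff)
    with w pos show "g w = balanced_point w" by (intro balanced_point_eqI) auto
  qed
  ultimately show "\<exists>U g. open U \<and> v \<in> U \<and> (\<forall>k. C_times k U g) \<and>
      (\<forall>x\<in>party_votes \<inter> U. g x = balanced_point x)"
    using U by blast
qed

theorem theorem12p3:
  "(\<forall>v \<in> (party_votes :: (real ^ ('n::finite set)) set).
      (\<exists>!x. x \<in> open_simplex \<and> balanced v x) \<and>
      (\<forall>s. thiele_run v s \<longrightarrow> seat_proportions s \<longlonglongrightarrow> balanced_point v)) \<and>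
   smooth_on (party_votes :: (real ^ ('n set)) set) balanced_point"
  using ex1_balanced seat_proportions_tendsto smooth_on_balanced_point by blast

end
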